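(* Let $\mathcal I$ be an ideal on $\mathbb N$. Then the following conditions are equivalent. (1) For every $\mathcal I^*$-nonincreasing sequence $(a_n)_{n\in\mathbb N}$ of positive reals: if $\sum_{n=1}^{\infty} a_n<\infty$ then $\mathcal I^*\text{-}\lim n a_n=0$. (2) For every $\mathcal I^*$-nonincreasing sequence $(a_n)_{n\in\mathbb N}$ of positive reals: if $\sum_{n=1}^{\infty} a_n<\infty$ then $\mathcal I\text{-}\lim n a_n=0$. (3) For every $X\in\mathcal I^+$, $\mathcal I_{X}\cap \mathcal I^*=\emptyset$.
   Context: $\mathbb N=\{1,2,\dots\}$. An ideal on $\mathbb N$ is a nonempty family $\mathcal I\subseteq\mathcal P(\mathbb N)$ closed under subsets and finite unions, containing all finite subsets of $\mathbb N$, with $\mathbb N\notin\mathcal I$. $\mathcal I^*=\{\mathbb N\setminus A: A\in\mathcal I\}$ is the dual filter and $\mathcal I^+=\{A\subseteq\mathbb N:A\notin\mathcal I\}$ is the coideal. For a real sequence $(x_n)$: $\mathcal I\text{-}\lim x_n=L$ means $\{n\in\mathbb N:|x_n-L|\ge\varepsilon\}\in\mathcal I$ for every $\varepsilon>0$; $\mathcal I^*\text{-}\lim x_n=L$ means there is $F\in\mathcal I^*$ such that the subsequence $(x_n)_{n\in F}$ converges to $L$ in the ordinary sense. A real sequence $(a_n)$ is $\mathcal I^*$-nonincreasing if there is $F\in\mathcal I^*$ such that $a_n\ge a_k$ for all $n,k\in F$ with $n\le k$. For an infinite set $X=\{x_1<x_2<\dots\}\subseteq\mathbb N$ put $x_0=0$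 and define $f_X:\mathbb N\to\mathbb R$ by $f_X(i)=\frac1{x_n}$ where $n$ is the unique index with $i\in(x_{n-1},x_n]$; then $\mathcal I_X=\{A\subseteq\mathbb N:\sum_{n\in A}f_X(n)<\infty\}$. (Every $X\in\mathcal I^+$ is infinite.) *)

theory Defs
  imports "HOL-Analysis.Analysis"
begin

text \<open>The natural numbers are \<open>{1, 2, \<dots>}\<close>. Sequences are functions on \<^typ>\<open>nat\<close>
  whose value at \<open>0\<close> is never used.\<close>

abbreviation posnats :: "nat set" where
  "posnats \<equiv> {1..}"

definition ideal_on_posnats :: "nat set set \<Rightarrow> bool" where
  "ideal_on_posnats I \<longleftrightarrow>
     I \<noteq> {} \<and> I \<subseteq> Pow posnats \<and>
     (\<forall>A\<in>I. \<forall>B. B \<subseteq> A \<longrightarrow> B \<in> I) \<and>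
     (\<forall>A\<in>I. \<forall>B\<in>I. A \<union> B \<in> I) \<and>
     (\<forall>A. finite A \<and> A \<subseteq> posnats \<longrightarrow> A \<in> I) \<and>
     posnats \<notin> I"

definition dual_filter :: "nat set set \<Rightarrow> nat set set" where
  "dual_filter I = {posnats - A | A. A \<in> I}"

definition coideal :: "nat set set \<Rightarrow> nat set set" where
  "coideal I = {A. A \<subseteq> posnats \<and> A \<notin> I}"

definition ideal_lim :: "nat set set \<Rightarrow> (nat \<Rightarrow> real) \<Rightarrow> real \<Rightarrow> bool" where
  "ideal_lim I x L \<longleftrightarrow> (\<forall>\<epsilon>>0. {n \<in> posnats. \<bar>x n - L\<bar> \<ge> \<epsilon>} \<in> I)"

text \<open>Members of the dual filter of an ideal are infinite, so \<^term>\<open>enumerate F\<close> lists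
  all of \<open>F\<close> increasingly.\<close>

definition ideal_star_lim :: "nat set set \<Rightarrow> (nat \<Rightarrow> real) \<Rightarrow> real \<Rightarrow> bool" where
  "ideal_star_lim I x L \<longleftrightarrow>
     (\<exists>F\<in>dual_filter I. (\<lambda>k. x (enumerate F k)) \<longlonglongrightarrow> L)"

definition ideal_star_nonincreasing :: "nat set set \<Rightarrow> (nat \<Rightarrow> real) \<Rightarrow> bool" where
  "ideal_star_nonincreasing I a \<longleftrightarrow>
     (\<exists>F\<in>dual_filter I. \<forall>n\<in>F. \<forall>k\<in>F. n \<le> k \<longrightarrow> a k \<le> a n)"

text \<open>For \<open>X = {x\<^sub>1 < x\<^sub>2 < \<dots>}\<close>, \<open>endpoint X n\<close> is \<open>x\<^sub>n\<close>, with \<open>x\<^sub>0 = 0\<close>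
  (\<^const>\<open>enumerate\<close> counts from \<open>0\<close>).\<close>

definition endpoint :: "nat set \<Rightarrow> nat \<Rightarrow> nat" where
  "endpoint X n = (if n = 0 then 0 else enumerate X (n - 1))"

definition block_index :: "nat set \<Rightarrow> nat \<Rightarrow> nat" where
  "block_index X i = (THE n. n \<ge> 1 \<and> i \<in> {endpoint X (n - 1)<..endpoint X n})"

definition block_fun :: "nat set \<Rightarrow> nat \<Rightarrow> real" where
  "block_fun X i = 1 / real (endpoint X (block_index X i))"

text \<open>As \<^term>\<open>block_fun X\<close> is nonnegative, \<^const>\<open>summable_on\<close> says that the sum over \<open>A\<close>
  is finite.\<close>

definition block_ideal :: "nat set \<Rightarrow> nat set set" where
  "block_ideal X = {A. A \<subseteq> posnats \<and> block_fun X summable_on A}"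

lemma strict_mono_endpoint:
  assumes "infinite X" "X \<subseteq> posnats"
  shows "strict_mono (endpoint X)"
proof (rule strict_monoI_Suc)
  fix n
  show "endpoint X n < endpoint X (Suc n)"
  proof (cases n)
    case 0
    have "enumerate X 0 \<in> X"
      using assms(1) by (rule enumerate_in_set)
    with assms(2) have "enumerate X 0 > 0"
      by fastforce
    with 0 show ?thesis
      by (simp add: endpoint_def)
  next
    case (Suc m)
    with assms(1) show ?thesis
      by (simp add: endpoint_def enumerate_mono)
  qed
qed

lemma ex1_block_index:
  assumes X: "infinite X" "X \<subseteq> posnats" and i: "i \<in> posnats"
  shows "\<exists>!n. n \<ge> 1 \<and> i \<in> {endpoint X (n - 1)<..endpoint X n}"
proof -
  note mono = strict_mono_endpoint[OF X]
  define n where "n = (LEAST n. i \<le> endpoint X n)"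
  have "i \<le> endpoint X i"
    using mono by (rule strict_mono_imp_increasing)
  then have le: "i \<le> endpoint X n"
    unfolding n_def by (rule LeastI)
  have n: "n \<ge> 1"
    using le i by (cases n) (auto simp: endpoint_def)
  then have less: "endpoint X (n - 1) < i"
    using not_less_Least[of "n - 1" "\<lambda>n. i \<le> endpoint X n"] by (simp add: n_def)
  have "m = n" if m: "m \<ge> 1" "endpoint X (m - 1) < i" "i \<le> endpoint X m" for m
  proof (rule linorder_cases[of m n])
    assume "m < n"
    then show ?thesis
      using not_less_Least[of m "\<lambda>n. i \<le> endpoint X n"] m(3) by (simp add: n_def)
  next
    assume "m > n"
    then have "endpoint X n \<le> endpoint X (m - 1)"
      using mono by (simp add: strict_mono_less_eq)
    with le m(2) show ?thesis
      by simp
  qed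
  then show ?thesis
    unfolding greaterThanAtMost_iff using n less le by blast
qed

end

theory Submission
  imports Defs
begin

text \<open>If \<open>F\<close> lies in both the dual filter and the block ideal of \<open>X \<in> I\<^sup>+\<close>, then \<open>block_fun X\<close> on \<open>F\<close>,
  continued by \<open>2\<^sup>-\<^sup>n\<close> off \<open>F\<close>, violates (2), because \<open>n a\<^sub>n = 1\<close> on \<open>X \<inter> F\<close>.

  For (3) \<open>\<Longrightarrow>\<close> (1), let \<open>a\<close> be summable and nonincreasing on \<open>F\<close>. Choose weights \<open>g \<rightarrow> \<infinity>\<close> that keep
  \<open>\<Sum> g(n) a\<^sub>n\<close> finite. If \<open>A\<^sub>k = {n \<in> F. n a\<^sub>n \<ge> \<epsilon>/(k+1)}\<close> is infinite for every \<open>k\<close>, pick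
  \<open>m\<^sub>0 < m\<^sub>1 < \<dots>\<close> with \<open>m\<^sub>k \<in> A\<^sub>k\<close> and \<open>g(m\<^sub>k) \<ge> k+2\<close>, and let \<open>X\<close> be the union of the
  \<open>A\<^sub>k \<inter> [m\<^sub>k, \<infinity>)\<close>. Off \<open>X\<close> we have \<open>n a\<^sub>n \<rightarrow> 0\<close> along \<open>F\<close>. As \<open>m\<^sub>k \<in> X\<close>, no block of \<open>X\<close> crosses an
  \<open>m\<^sub>k\<close>, so \<open>\<epsilon> \<cdot> block_fun X i \<le> g(i) a\<^sub>i\<close> for \<open>i \<in> F\<close> beyond \<open>m\<^sub>0\<close>. Thus \<open>F\<close> is in the block ideal
  of \<open>X\<close>, and (3) forces \<open>X \<in> I\<close>.\<close>

section \<open>The block function through the next element of \<open>X\<close>\<close>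

lemma block_fun_eq:
  assumes X: "infinite X" "X \<subseteq> posnats" and i: "i \<in> posnats"
  shows "block_fun X i = 1 / real (LEAST x. x \<in> X \<and> i \<le> x)"
proof -
  define n where "n = block_index X i"
  have n: "n \<ge> 1" "endpoint X (n - 1) < i" "i \<le> endpoint X n"
    using theI'[OF ex1_block_index[OF X i]] by (auto simp: n_def block_index_def)
  have "(LEAST x. x \<in> X \<and> i \<le> x) = endpoint X n"
  proof (rule Least_equality)
    show "endpoint X n \<in> X \<and> i \<le> endpoint X n"
      using n X(1) by (simp add: endpoint_def enumerate_in_set)
  next
    fix y assume y: "y \<in> X \<and> i \<le> y"
    then obtain j where j: "y = endpoint X (Suc j)"
      using enumerate_Ex[OF X(1), of y] by (auto simp: endpoint_def)
    \<comment> \<open>Every element of \<open>X\<close> is an endpoint, so one at or above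
      \<open>i\<close> lies past the left end of the block of \<open>i\<close>; its index is then at
      least \<open>n\<close>.\<close>
    have "endpoint X (n - 1) < endpoint X (Suc j)"
      using n(2) y j by simp
    then have "n \<le> Suc j"
      using strict_mono_less[OF strict_mono_endpoint[OF X]] by fastforce
    then show "endpoint X n \<le> y"
      using strict_mono_less_eq[OF strict_mono_endpoint[OF X]] j by simp
  qed
  then show ?thesis
    by (simp add: block_fun_def n_def)
qed

lemma next_element:
  fixes X :: "nat set"
  assumes "infinite X"
  shows "(LEAST x. x \<in> X \<and> i \<le> x) \<in> X" "i \<le> (LEAST x. x \<in> X \<and> i \<le> x)"
proof -
  have "\<exists>x. x \<in> X \<and> i \<le> x"
    using assms by (metis infinite_nat_iff_unbounded_le)
  then have "(LEAST x. x \<in> X \<and> i \<le> x) \<in> X \<and> i \<le> (LEAST x. x \<in> X \<and> i \<le> x)"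
    by (rule LeastI_ex)
  then show "(LEAST x. x \<in> X \<and> i \<le> x) \<in> X" "i \<le> (LEAST x. x \<in> X \<and> i \<le> x)"
    by auto
qed

lemma block_fun_pos:
  assumes X: "infinite X" "X \<subseteq> posnats" and i: "i \<in> posnats"
  shows "block_fun X i > 0"
  using next_element(2)[OF X(1), of i] i by (simp add: block_fun_eq[OF X i])

lemma block_fun_antimono:
  assumes X: "infinite X" "X \<subseteq> posnats" and "i \<in> posnats" "i \<le> j"
  shows "block_fun X j \<le> block_fun X i"
proof -
  have j: "j \<in> posnats"
    using assms by simp
  have "(LEAST x. x \<in> X \<and> i \<le> x) \<le> (LEAST x. x \<in> X \<and> j \<le> x)"
    using next_element[OF X(1), of j] \<open>i \<le> j\<close> by (intro Least_le) auto
  moreover have "(LEAST x. x \<in> X \<and> i \<le> x) > 0"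
    using next_element(2)[OF X(1), of i] \<open>i \<in> posnats\<close> by simp
  ultimately show ?thesis
    unfolding block_fun_eq[OF X j] block_fun_eq[OF X \<open>i \<in> posnats\<close>]
    by (simp add: frac_le)
qed

lemma block_fun_member:
  assumes X: "infinite X" "X \<subseteq> posnats" and "x \<in> X"
  shows "block_fun X x = 1 / real x"
proof -
  have "(LEAST y. y \<in> X \<and> x \<le> y) = x"
    using \<open>x \<in> X\<close> by (intro Least_equality) auto
  with assms show ?thesis
    by (subst block_fun_eq) auto
qed

section \<open>Convergence along a set; divergent weights\<close>

lemma tendsto_enumerate_iff:
  fixes x :: "nat \<Rightarrow> real"
  assumes "infinite F"
  shows "(\<lambda>k. x (enumerate F k)) \<longlonglongrightarrow> L \<longleftrightarrow> (\<forall>\<epsilon>>0. finite {n \<in> F. \<bar>x n - L\<bar> \<ge> \<epsilon>})"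
proof -
  have "{n \<in> F. \<bar>x n - L\<bar> \<ge> \<epsilon>} = enumerate F ` {k. \<bar>x (enumerate F k) - L\<bar> \<ge> \<epsilon>}" for \<epsilon>
    using enumerate_Ex[OF assms] enumerate_in_set[OF assms] by (auto simp: image_iff)
  moreover have "inj (enumerate F)"
    by (rule strict_mono_imp_inj_on[OF strict_mono_enumerate[OF assms]])
  ultimately have "finite {n \<in> F. \<bar>x n - L\<bar> \<ge> \<epsilon>} \<longleftrightarrow> finite {k. \<bar>x (enumerate F k) - L\<bar> \<ge> \<epsilon>}" for \<epsilon>
    by (simp add: finite_image_iff inj_on_subset)
  then show ?thesis
    by (simp add: tendsto_iff dist_real_def cofinite_eq_sequentially[symmetric]
        eventually_cofinite not_less)
qed

text \<open>The weight is the reciprocal square root of the tail sum \<open>r n\<close>: it diverges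
  because the tails vanish, while the weighted series is dominated by a telescoping one.\<close>

lemma summable_imp_divergent_weight:
  fixes a :: "nat \<Rightarrow> real"
  assumes pos: "\<And>n. a n > 0" and sum: "summable a"
  obtains g :: "nat \<Rightarrow> real"
  where "mono g" "filterlim g at_top sequentially" "summable (\<lambda>n. g n * a n)"
proof -
  define r where "r n = (\<Sum>i. a (i + n))" for n
  have r_pos: "r n > 0" for n
    unfolding r_def using pos sum by (intro suminf_pos summable_ignore_initial_segment)
  have a_eq: "a n = r n - r (Suc n)" for n
    unfolding r_def using suminf_split_head[OF summable_ignore_initial_segment[OF sum, of n]]
    by simp
  have r_Suc: "r (Suc n) \<le> r n" for n
    using pos[of n] a_eq[of n] by simp
  have r_lim: "r \<longlonglongrightarrow> 0"
    unfolding r_def by (rule suminf_exist_split2[OF sum])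
  define g where "g n = 1 / sqrt (r n)" for n
  have "mono g"
    unfolding mono_iff_le_Suc g_def using r_pos r_Suc by (auto intro!: frac_le)
  moreover have "filterlim g at_top sequentially"
    unfolding g_def inverse_eq_divide[symmetric]
  proof (rule filterlim_inverse_at_top)
    show "(\<lambda>n. sqrt (r n)) \<longlonglongrightarrow> 0"
      using tendsto_real_sqrt[OF r_lim] by simp
    show "\<forall>\<^sub>F n in sequentially. 0 < sqrt (r n)"
      using r_pos by simp
  qed
  moreover have "summable (\<lambda>n. g n * a n)"
  proof (rule summable_comparison_test')
    have "(\<lambda>n. sqrt (r n)) \<longlonglongrightarrow> 0"
      using tendsto_real_sqrt[OF r_lim] by simp
    then show "summable (\<lambda>n. 2 * (sqrt (r n) - sqrt (r (Suc n))))"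
      by (intro summable_mult telescope_summable')
    fix n :: nat
    let ?u = "sqrt (r n)" and ?v = "sqrt (r (Suc n))"
    have u: "?u > 0" and v: "?v \<le> ?u"
      using r_pos r_Suc by auto
    \<comment> \<open>A difference of squares: \<open>a n\<close> is the difference of consecutive
      tails, and the factor \<open>?u + ?v \<le> 2 * ?u\<close> absorbs the weight
      \<open>1 / ?u\<close>.\<close>
    have "a n = (?u - ?v) * (?u + ?v)"
      using r_pos[of n] r_pos[of "Suc n"] by (simp add: a_eq algebra_simps)
    also have "\<dots> \<le> (?u - ?v) * (2 * ?u)"
      using v by (intro mult_left_mono) auto
    finally have "g n * a n \<le> 2 * (?u - ?v)"
      using u by (simp add: g_def field_simps)
    moreover have "g n * a n \<ge> 0"
      using u pos[of n] by (simp add: g_def)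
    ultimately show "norm (g n * a n) \<le> 2 * (?u - ?v)"
      by simp
  qed
  ultimately show thesis
    by (rule that)
qed

section \<open>Ideals, dual filters and the two kinds of limit\<close>

context
  fixes I :: "nat set set"
  assumes I: "ideal_on_posnats I"
begin

lemma ideal_subset: "A \<in> I \<Longrightarrow> B \<subseteq> A \<Longrightarrow> B \<in> I"
  and ideal_Un: "A \<in> I \<Longrightarrow> B \<in> I \<Longrightarrow> A \<union> B \<in> I"
  and ideal_finite: "finite A \<Longrightarrow> A \<subseteq> posnats \<Longrightarrow> A \<in> I"
  and ideal_subset_posnats: "A \<in> I \<Longrightarrow> A \<subseteq> posnats"
proof -
  have *: "I \<subseteq> Pow posnats" "\<forall>A\<in>I. \<forall>B. B \<subseteq> A \<longrightarrow> B \<in> I" "\<forall>A\<in>I. \<forall>B\<in>I. A \<union> B \<in> I"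
    "\<forall>A. finite A \<and> A \<subseteq> posnats \<longrightarrow> A \<in> I"
    using I unfolding ideal_on_posnats_def by argo+
  show "A \<in> I \<Longrightarrow> B \<subseteq> A \<Longrightarrow> B \<in> I"
    using *(2) by blast
  show "A \<in> I \<Longrightarrow> B \<in> I \<Longrightarrow> A \<union> B \<in> I"
    using *(3) by blast
  show "finite A \<Longrightarrow> A \<subseteq> posnats \<Longrightarrow> A \<in> I"
    using *(4) by simp
  show "A \<in> I \<Longrightarrow> A \<subseteq> posnats"
    using *(1) by blast
qed

lemma dual_filter_iff: "F \<in> dual_filter I \<longleftrightarrow> F \<subseteq> posnats \<and> posnats - F \<in> I"
proof
  assume "F \<in> dual_filter I"
  then obtain A where A: "F = posnats - A" "A \<in> I"
    by (auto simp: dual_filter_def)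
  then show "F \<subseteq> posnats \<and> posnats - F \<in> I"
    using ideal_subset_posnats[OF A(2)] by (simp add: double_diff)
next
  assume "F \<subseteq> posnats \<and> posnats - F \<in> I"
  then show "F \<in> dual_filter I"
    unfolding dual_filter_def by (intro CollectI exI[of _ "posnats - F"]) (simp add: double_diff)
qed

lemma coideal_infinite: "X \<in> coideal I \<Longrightarrow> infinite X"
  using ideal_finite[of X] unfolding coideal_def by fast

lemma dual_filter_infinite: "F \<in> dual_filter I \<Longrightarrow> infinite F"
proof
  assume F: "F \<in> dual_filter I" "finite F"
  then have "(posnats - F) \<union> F \<in> I"
    using ideal_Un ideal_finite dual_filter_iff by blast
  moreover have "(posnats - F) \<union> F = posnats"
    using F by (auto simp: dual_filter_iff)
  ultimately show False
    using I by (simp add: ideal_on_posnats_def)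
qed

lemma dual_filter_Diff:
  assumes "F \<in> dual_filter I" "A \<in> I"
  shows "F - A \<in> dual_filter I"
proof -
  have "(posnats - F) \<union> A \<in> I"
    using assms by (intro ideal_Un) (simp_all add: dual_filter_iff)
  then have "posnats - (F - A) \<in> I"
    by (rule ideal_subset) blast
  with assms(1) show ?thesis
    by (auto simp: dual_filter_iff)
qed

text \<open>The part of \<open>X\<close> outside \<open>F\<close> is in the ideal, so the part
  inside cannot be.\<close>

lemma coideal_Int_dual_filter:
  assumes "X \<in> coideal I" "F \<in> dual_filter I"
  shows "X \<inter> F \<notin> I"
proof
  assume "X \<inter> F \<in> I"
  then have "(X \<inter> F) \<union> (posnats - F) \<in> I"
    using assms by (intro ideal_Un) (auto simp: dual_filter_iff)
  then have "X \<in> I"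
    by (rule ideal_subset) (use assms in \<open>auto simp: coideal_def\<close>)
  with assms show False
    by (simp add: coideal_def)
qed

lemma ideal_star_lim_iff:
  "ideal_star_lim I x L \<longleftrightarrow> (\<exists>F\<in>dual_filter I. \<forall>\<epsilon>>0. finite {n \<in> F. \<bar>x n - L\<bar> \<ge> \<epsilon>})"
  unfolding ideal_star_lim_def
proof (rule bex_cong[OF refl])
  fix F assume "F \<in> dual_filter I"
  then show "(\<lambda>k. x (enumerate F k)) \<longlonglongrightarrow> L \<longleftrightarrow> (\<forall>\<epsilon>>0. finite {n \<in> F. \<bar>x n - L\<bar> \<ge> \<epsilon>})"
    by (rule tendsto_enumerate_iff[OF dual_filter_infinite])
qed

text \<open>The exceptional set splits into a finite part inside \<open>F\<close> and a part outside
  \<open>F\<close>; both belong to the ideal.\<close>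

lemma ideal_star_lim_imp_ideal_lim:
  assumes "ideal_star_lim I x L"
  shows "ideal_lim I x L"
  unfolding ideal_lim_def
proof (intro allI impI)
  fix \<epsilon> :: real assume "\<epsilon> > 0"
  obtain F where F: "F \<in> dual_filter I" "finite {n \<in> F. \<bar>x n - L\<bar> \<ge> \<epsilon>}"
    using assms \<open>\<epsilon> > 0\<close> unfolding ideal_star_lim_iff by blast
  have "(posnats - F) \<union> {n \<in> F. \<bar>x n - L\<bar> \<ge> \<epsilon>} \<in> I"
    using F(1) by (intro ideal_Un ideal_finite[OF F(2)]) (auto simp: dual_filter_iff)
  then show "{n \<in> posnats. \<bar>x n - L\<bar> \<ge> \<epsilon>} \<in> I"
    by (rule ideal_subset) auto
qed

section \<open>From (2) to (3)\<close>

lemma block_ideal_counterexample: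
  assumes X: "X \<in> coideal I" and F: "F \<in> block_ideal X" "F \<in> dual_filter I"
  obtains a :: "nat \<Rightarrow> real"
  where "\<And>n. n \<in> posnats \<Longrightarrow> a n > 0" "ideal_star_nonincreasing I a" "summable (\<lambda>n. a (Suc n))"
    "\<not> ideal_lim I (\<lambda>n. real n * a n) 0"
proof -
  have X': "infinite X" "X \<subseteq> posnats"
    using X coideal_infinite by (auto simp: coideal_def)
  have F': "F \<subseteq> posnats" "block_fun X summable_on F"
    using F by (auto simp: block_ideal_def)
  define a :: "nat \<Rightarrow> real" where "a n = (if n \<in> F then block_fun X n else (1/2) ^ n)" for n
  have pos: "a n > 0" if "n \<in> posnats" for n
    using that block_fun_pos[OF X'] by (simp add: a_def)
  moreover have "ideal_star_nonincreasing I a"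
    unfolding ideal_star_nonincreasing_def
    using F(2) block_fun_antimono[OF X'] F'(1) by (intro bexI[of _ F]) (auto simp: a_def)
  moreover have "summable a"
  proof -
    \<comment> \<open>Extension by zero turns the unordered sum over \<open>F\<close> into an
      ordinary series; adding the geometric series then dominates \<open>a\<close>.\<close>
    have "(\<lambda>n. if n \<in> F then block_fun X n else 0) summable_on UNIV"
      using F'(2) by (subst summable_on_cong_neutral[of F _ "block_fun X"]) auto
    then have "summable (\<lambda>n. if n \<in> F then block_fun X n else 0)"
      by (rule summable_on_imp_summable)
    then have "summable (\<lambda>n. (if n \<in> F then block_fun X n else 0) + (1/2::real) ^ n)"
      by (intro summable_add summable_geometric) auto
    then show ?thesis
    proof (rule summable_comparison_test'[where N = 0])
      show "norm (a n) \<le> (if n \<in> F then block_fun X n else 0) + (1/2) ^ n" for n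
        using block_fun_pos[OF X', of n] F'(1) by (auto simp: a_def subset_iff)
    qed
  qed
  moreover have "\<not> ideal_lim I (\<lambda>n. real n * a n) 0"
  proof
    assume "ideal_lim I (\<lambda>n. real n * a n) 0"
    then have "{n \<in> posnats. \<bar>real n * a n - 0\<bar> \<ge> 1} \<in> I"
      unfolding ideal_lim_def using zero_less_one by blast
    moreover have "X \<inter> F \<subseteq> {n \<in> posnats. \<bar>real n * a n - 0\<bar> \<ge> 1}"
      using X'(2) block_fun_member[OF X'] by (auto simp: a_def)
    ultimately show False
      using coideal_Int_dual_filter[OF X F(2)] ideal_subset by blast
  qed
  ultimately show thesis
    by (intro that) (auto simp: summable_Suc_iff)
qed

section \<open>From (3) to (1)\<close>

lemma dual_filter_in_block_ideal:
  fixes a :: "nat \<Rightarrow> real"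
  assumes pos: "\<And>n. n \<in> posnats \<Longrightarrow> a n > 0"
    and F: "F \<in> dual_filter I"
    and antimono: "\<And>n k. n \<in> F \<Longrightarrow> k \<in> F \<Longrightarrow> n \<le> k \<Longrightarrow> a k \<le> a n"
    and sum: "summable (\<lambda>n. a (Suc n))"
    and \<epsilon>: "\<epsilon> > 0" "infinite {n \<in> F. real n * a n \<ge> \<epsilon>}"
  obtains X where "X \<subseteq> F" "F \<in> block_ideal X"
    "\<And>\<delta>. \<delta> > 0 \<Longrightarrow> finite {n \<in> F - X. real n * a n \<ge> \<delta>}"
proof -
  have F_pos: "F \<subseteq> posnats"
    using F by (simp add: dual_filter_iff)
  obtain g0 :: "nat \<Rightarrow> real" where g0: "mono g0" "filterlim g0 at_top sequentially"
    "summable (\<lambda>n. g0 n * a (Suc n))"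
  proof (rule summable_imp_divergent_weight[OF _ sum])
    show "a (Suc n) > 0" for n
      using pos by simp
  qed
  \<comment> \<open>\<open>g0\<close> belongs to the shifted sequence \<open>a (Suc n)\<close>; this
    shifts it back. The term at index 0 cannot affect summability.\<close>
  define g where "g n = g0 (n - 1)" for n
  have g_mono: "g i \<le> g j" if "i \<le> j" for i j
    using that monoD[OF g0(1), of "i - 1" "j - 1"] by (simp add: g_def)
  have g_top: "\<exists>N. \<forall>n\<ge>N. C \<le> g n" for C
  proof -
    obtain N where N: "\<And>n. n \<ge> N \<Longrightarrow> C \<le> g0 n"
      using g0(2) by (auto simp: filterlim_at_top eventually_sequentially)
    then show ?thesis
      unfolding g_def by (intro exI[of _ "Suc N"]) auto
  qed
  have g_sum: "summable (\<lambda>n. g n * a n)"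
    using g0(3) by (subst summable_Suc_iff[symmetric]) (simp add: g_def)
  define A where "A k = {n \<in> F. real n * a n * real (Suc k) \<ge> \<epsilon>}" for k
  have A_mono: "A j \<subseteq> A k" if "j \<le> k" for j k
  proof
    fix n assume n: "n \<in> A j"
    then have "real n * a n \<ge> 0"
      using pos F_pos by (force simp: A_def)
    then have "real n * a n * real (Suc j) \<le> real n * a n * real (Suc k)"
      using that by (intro mult_left_mono) auto
    with n show "n \<in> A k"
      unfolding A_def by auto
  qed
  have A_inf: "infinite (A k)" for k
  proof -
    have "A 0 = {n \<in> F. real n * a n \<ge> \<epsilon>}"
      by (simp add: A_def)
    then show ?thesis
      using A_mono[of 0 k] \<epsilon>(2) infinite_super by auto
  qed
  have A_ex: "\<exists>n. n \<in> A k \<and> real k + 2 \<le> g n \<and> N \<le> n" for k N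
  proof -
    obtain M where M: "\<And>n. n \<ge> M \<Longrightarrow> real k + 2 \<le> g n"
      using g_top by blast
    obtain n where "n \<in> A k" "n \<ge> max M N"
      using A_inf[of k] unfolding infinite_nat_iff_unbounded_le by blast
    with M show ?thesis
      by auto
  qed
  \<comment> \<open>Why \<open>k + 2\<close>: a point between \<open>m k\<close> and
    \<open>m (Suc k)\<close> has its next element of \<open>X\<close> in \<open>A (Suc k)\<close>,
    whose threshold is \<epsilon>/(k+2). The weight at \<open>m k\<close> must make up for that
    denominator.\<close>
  have "\<exists>m. \<forall>k. (m k \<in> A k \<and> real k + 2 \<le> g (m k)) \<and> m k < m (Suc k)"
  proof (rule dependent_nat_choice)
    show "\<exists>n. n \<in> A 0 \<and> real 0 + 2 \<le> g n"
      using A_ex by blast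
    show "\<exists>y. (y \<in> A (Suc k) \<and> real (Suc k) + 2 \<le> g y) \<and> x < y" for x k
      using A_ex[of "Suc k" "Suc x"] by auto
  qed
  then obtain m where m: "\<And>k. m k \<in> A k" "\<And>k. real k + 2 \<le> g (m k)" "\<And>k. m k < m (Suc k)"
    by blast
  have m_mono: "strict_mono m"
    using m(3) by (simp add: strict_mono_Suc_iff)
  define X where "X = (\<Union>k. A k \<inter> {m k..})"
  have X_inf: "infinite X"
  proof -
    have "range m \<subseteq> X"
      using m(1) by (auto simp: X_def)
    then show ?thesis
      using range_inj_infinite[OF strict_mono_imp_inj_on[OF m_mono]] infinite_super by blast
  qed
  have XF: "X \<subseteq> F"
    by (auto simp: X_def A_def)
  have X_pos: "X \<subseteq> posnats"
    using XF F_pos by (rule order_trans)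
  have bound: "block_fun X i \<le> 1 / \<epsilon> * (g i * a i)" if i: "i \<in> F" "m 0 < i" for i
  proof -
    have "\<exists>k. i \<le> m (Suc k)"
      using strict_mono_imp_increasing[OF m_mono, of "Suc i"] by (intro exI[of _ i]) auto
    \<comment> \<open>The least such \<open>k\<close> gives \<open>m k < i \<le> m (Suc k)\<close>;
      the assumption \<open>m 0 < i\<close> settles the case \<open>k = 0\<close>.\<close>
    then obtain k where k: "i \<le> m (Suc k)" "\<And>j. j < k \<Longrightarrow> \<not> i \<le> m (Suc j)"
      using exists_least_iff[of "\<lambda>k. i \<le> m (Suc k)"] by blast
    have mk: "m k < i"
      using k(2)[of "k - 1"] i(2) by (cases k) auto
    define x where "x = (LEAST x. x \<in> X \<and> i \<le> x)"
    have x: "x \<in> X" "i \<le> x"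
      unfolding x_def by (rule next_element[OF X_inf])+
    \<comment> \<open>Since \<open>m (Suc k)\<close> is in \<open>X\<close>, the next element
      \<open>x\<close> cannot pass it. So \<open>x\<close> entered \<open>X\<close> through some
      \<open>A j\<close> with \<open>j \<le> Suc k\<close>, and these sets increase.\<close>
    have "x \<le> m (Suc k)"
      unfolding x_def using k(1) m(1) by (intro Least_le) (auto simp: X_def)
    moreover obtain j where j: "x \<in> A j" "m j \<le> x"
      using x(1) by (auto simp: X_def)
    ultimately have "j \<le> Suc k"
      using strict_mono_less_eq[OF m_mono] order_trans by blast
    then have "x \<in> A (Suc k)"
      using A_mono j(1) by blast
    then have xA: "\<epsilon> \<le> real x * a x * (real k + 2)" "x \<in> F"
      by (auto simp: A_def add_ac)
    have x_pos: "x > 0" and ai: "a i > 0" and i_pos: "i \<in> posnats"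
      using x(2) i(1) F_pos pos by auto
    \<comment> \<open>Monotonicity on \<open>F\<close> gives \<open>a x \<le> a i\<close>, and
      \<open>k + 2 \<le> g (m k) \<le> g i\<close>. Multiplying by \<open>x\<close> brings in the
      lower bound from \<open>xA\<close>.\<close>
    have "a x * (real k + 2) \<le> a i * g i"
      using antimono[OF i(1) xA(2) x(2)] m(2)[of k] g_mono[of "m k" i] mk ai
      by (intro mult_mono) auto
    then have "real x * (a x * (real k + 2)) \<le> real x * (a i * g i)"
      by (intro mult_left_mono) auto
    then have "\<epsilon> \<le> real x * (g i * a i)"
      using xA(1) by (simp add: mult_ac)
    then have "1 / real x \<le> 1 / \<epsilon> * (g i * a i)"
      using \<epsilon>(1) x_pos by (simp add: field_simps)
    then show ?thesis
      using block_fun_eq[OF X_inf X_pos i_pos] by (simp add: x_def)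
  qed
  have "F \<in> block_ideal X"
  proof -
    \<comment> \<open>The bound holds only beyond \<open>m 0\<close>; the finite rest of
      \<open>F\<close> is added back at the end.\<close>
    let ?G = "F \<inter> {m 0<..}"
    have nonneg: "block_fun X i \<ge> 0" if "i \<in> F" for i
      using that F_pos block_fun_pos[OF X_inf X_pos, of i] by auto
    have "summable (\<lambda>i. if i \<in> ?G then block_fun X i else 0)"
    proof (rule summable_comparison_test')
      show "summable (\<lambda>i. 1 / \<epsilon> * (g i * a i))"
        using g_sum by (rule summable_mult)
      fix i assume "i \<ge> Suc (m 0)"
      \<comment> \<open>The majorant must be nonnegative off \<open>F\<close> too; past
        \<open>m 0\<close> the weight is at least 2.\<close>
      then have "i \<in> posnats" "g i \<ge> 0"
        using m(2)[of 0] g_mono[of "m 0" i] by auto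
      then have "1 / \<epsilon> * (g i * a i) \<ge> 0"
        using pos[of i] \<epsilon>(1) by simp
      then show "norm (if i \<in> ?G then block_fun X i else 0) \<le> 1 / \<epsilon> * (g i * a i)"
        using bound[of i] nonneg[of i] by auto
    qed
    then have "(\<lambda>i. if i \<in> ?G then block_fun X i else 0) summable_on UNIV"
      using nonneg by (subst summable_on_UNIV_nonneg_real_iff) auto
    then have "block_fun X summable_on ?G"
      by (subst (asm) summable_on_cong_neutral[of ?G _ "block_fun X"]) auto
    then have "block_fun X summable_on (?G \<union> F \<inter> {..m 0})"
      by (rule summable_on_Un_disjoint) auto
    moreover have "?G \<union> F \<inter> {..m 0} = F"
      by auto
    ultimately show ?thesis
      using F_pos by (simp add: block_ideal_def)
  qed
  moreover have "finite {n \<in> F - X. real n * a n \<ge> \<delta>}" if "\<delta> > 0" for \<delta>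
  proof -
    \<comment> \<open>For this \<open>k\<close>, \<epsilon>/(k+1) < \<delta>, so every exceptional
      point is in \<open>A k\<close>. Those from \<open>m k\<close> on were put into
      \<open>X\<close>, leaving only points below \<open>m k\<close>.\<close>
    obtain k where "\<epsilon> / \<delta> < real k"
      using reals_Archimedean2 by blast
    then have k: "\<epsilon> < \<delta> * real (Suc k)"
      using \<open>\<delta> > 0\<close> by (simp add: field_simps)
    have "n < m k" if n: "n \<in> F - X" "real n * a n \<ge> \<delta>" for n
    proof (rule ccontr)
      assume "\<not> n < m k"
      with n(1) have "n \<notin> A k"
        by (auto simp: X_def)
      then have "real n * a n * real (Suc k) < \<epsilon>"
        using n(1) by (simp add: A_def)
      moreover have "\<delta> * real (Suc k) \<le> real n * a n * real (Suc k)"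
        using n(2) by (intro mult_right_mono) auto
      ultimately show False
        using k by linarith
    qed
    then show ?thesis
      by (intro finite_subset[OF _ finite_lessThan[of "m k"]]) auto
  qed
  ultimately show thesis
    using XF by (intro that[of X])
qed

text \<open>Either \<open>F\<close> itself witnesses the limit, or the preceding lemma yields an
  \<open>X\<close> with \<open>F\<close> in both its block ideal and the dual filter. By
  \<open>blocks\<close> this \<open>X\<close> is in the ideal, and \<open>F - X\<close> is the
  witness.\<close>

lemma ideal_star_lim_of_block_ideals:
  fixes a :: "nat \<Rightarrow> real"
  assumes blocks: "\<And>X. X \<in> coideal I \<Longrightarrow> block_ideal X \<inter> dual_filter I = {}"
    and pos: "\<And>n. n \<in> posnats \<Longrightarrow> a n > 0"
    and "ideal_star_nonincreasing I a"
    and sum: "summable (\<lambda>n. a (Suc n))"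
  shows "ideal_star_lim I (\<lambda>n. real n * a n) 0"
proof -
  obtain F where F: "F \<in> dual_filter I"
    and antimono: "\<And>n k. n \<in> F \<Longrightarrow> k \<in> F \<Longrightarrow> n \<le> k \<Longrightarrow> a k \<le> a n"
    using assms(3) unfolding ideal_star_nonincreasing_def by blast
  have F_pos: "F \<subseteq> posnats"
    using F by (simp add: dual_filter_iff)
  have abs_eq: "\<bar>real n * a n - 0\<bar> = real n * a n" if "n \<in> F" for n
    using that F_pos pos[of n] by auto
  show ?thesis
  proof (cases "\<forall>\<epsilon>>0. finite {n \<in> F. real n * a n \<ge> \<epsilon>}")
    case True
    then show ?thesis
      unfolding ideal_star_lim_iff using F abs_eq by (intro bexI[of _ F]) (simp_all cong: conj_cong)
  next
    case False
    then obtain \<epsilon> where \<epsilon>: "\<epsilon> > 0" "infinite {n \<in> F. real n * a n \<ge> \<epsilon>}"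
      by blast
    show ?thesis
    proof (rule dual_filter_in_block_ideal[OF pos F antimono sum \<epsilon>])
      fix X assume X: "X \<subseteq> F" "F \<in> block_ideal X"
        "\<And>\<delta>. \<delta> > 0 \<Longrightarrow> finite {n \<in> F - X. real n * a n \<ge> \<delta>}"
      then have "X \<in> I"
        using blocks[of X] F F_pos by (auto simp: coideal_def)
      then have "F - X \<in> dual_filter I"
        by (rule dual_filter_Diff[OF F])
      moreover have "{n \<in> F - X. \<bar>real n * a n - 0\<bar> \<ge> \<delta>} = {n \<in> F - X. real n * a n \<ge> \<delta>}" for \<delta>
        using abs_eq by auto
      ultimately show ?thesis
        unfolding ideal_star_lim_iff using X(3) by (intro bexI[of _ "F - X"]) auto
    qed
  qed
qed

end

section \<open>The equivalence\<close>

theorem theorem3p3: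
  fixes I :: "nat set set"
  assumes "ideal_on_posnats I"
  shows
    "((\<forall>a :: nat \<Rightarrow> real. (\<forall>n\<in>posnats. a n > 0) \<and> ideal_star_nonincreasing I a \<longrightarrow>
          (summable (\<lambda>n. a (Suc n)) \<longrightarrow> ideal_star_lim I (\<lambda>n. real n * a n) 0))
      \<longleftrightarrow>
      (\<forall>a :: nat \<Rightarrow> real. (\<forall>n\<in>posnats. a n > 0) \<and> ideal_star_nonincreasing I a \<longrightarrow>
          (summable (\<lambda>n. a (Suc n)) \<longrightarrow> ideal_lim I (\<lambda>n. real n * a n) 0)))
     \<and>
     ((\<forall>a :: nat \<Rightarrow> real. (\<forall>n\<in>posnats. a n > 0) \<and> ideal_star_nonincreasing I a \<longrightarrow>
          (summable (\<lambda>n. a (Suc n)) \<longrightarrow> ideal_lim I (\<lambda>n. real n * a n) 0))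
      \<longleftrightarrow>
      (\<forall>X\<in>coideal I. block_ideal X \<inter> dual_filter I = {}))"
proof -
  let ?P = "\<lambda>a :: nat \<Rightarrow> real. (\<forall>n\<in>posnats. a n > 0) \<and> ideal_star_nonincreasing I a"
  let ?star = "\<forall>a. ?P a \<longrightarrow> (summable (\<lambda>n. a (Suc n)) \<longrightarrow> ideal_star_lim I (\<lambda>n. real n * a n) 0)"
  let ?lim = "\<forall>a. ?P a \<longrightarrow> (summable (\<lambda>n. a (Suc n)) \<longrightarrow> ideal_lim I (\<lambda>n. real n * a n) 0)"
  let ?blocks = "\<forall>X\<in>coideal I. block_ideal X \<inter> dual_filter I = {}"
  \<comment> \<open>The implications are proved as a cycle: \<open>?star\<close> to
    \<open>?lim\<close> to \<open>?blocks\<close> and back to \<open>?star\<close>.\<close>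
  have "?lim" if ?star
    by (intro allI impI ideal_star_lim_imp_ideal_lim[OF assms] that[rule_format])
  moreover have "?blocks" if lim: ?lim
  proof (rule ballI, rule ccontr)
    fix X assume X: "X \<in> coideal I" "block_ideal X \<inter> dual_filter I \<noteq> {}"
    then obtain F where F: "F \<in> block_ideal X" "F \<in> dual_filter I"
      by blast
    show False
    proof (rule block_ideal_counterexample[OF assms X(1) F])
      fix a :: "nat \<Rightarrow> real"
      assume a: "\<And>n. n \<in> posnats \<Longrightarrow> a n > 0" "ideal_star_nonincreasing I a"
        "summable (\<lambda>n. a (Suc n))" "\<not> ideal_lim I (\<lambda>n. real n * a n) 0"
      have "ideal_lim I (\<lambda>n. real n * a n) 0"
        using a(1-3) by (intro lim[rule_format] conjI ballI)
      with a(4) show False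
        by contradiction
    qed
  qed
  moreover have "?star" if ?blocks
  proof (intro allI impI)
    fix a assume "?P a" "summable (\<lambda>n. a (Suc n))"
    with that show "ideal_star_lim I (\<lambda>n. real n * a n) 0"
      by (intro ideal_star_lim_of_block_ideals[OF assms]) auto
  qed
  ultimately show ?thesis
    by argo
qed

end
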